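(* Let $\sigma=\pm1$, let $q$ be a nowhere vanishing smooth complex-valued function of $x$, and let $\hat{\mathcal L}=-\lambda^2+E\lambda+F$ with $E=\frac{iq_x}{q}$ and $F=-\frac14E^2-\sigma|q|^2+\frac i2E'$. Let $n\ge0$, let $\phi_n=\sum_{k=0}^nA_k\lambda^{n-k}$ be the normalized NLS $n$-soliton, and let $\mathcal H_n(\lambda)=\phi_n\phi_n''-\frac12(\phi_n')^2-2\hat{\mathcal L}\phi_n^2$. Then $$\mathcal H_n(\lambda)=8\lambda^{2n+2}-8A_{n+1}\lambda^{n+1}+\sum_{i=1}^n\Big\{\int\big[-4A_iA_{n+1}'+A_{i-1}B_n\big]dx\Big\}\lambda^{n+1-i}+\int A_nB_n\,dx,$$ where $B_n=A_n'''-2\langle F,A_n\rangle$.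
   Context: Setting: $x$ ranges over an open interval of $\mathbb R$, all functions of $x$ are smooth and complex valued, $'$ and the subscript $x$ denote $d/dx$, and $\lambda$ is an $x$-independent parameter; identities between polynomials in $\lambda$ are coefficientwise. Bilinear operator: $\langle\psi,\phi\rangle:=\psi'\phi+2\psi\phi'$. Integration convention: treat $E,F$ as differential indeterminates; a differential polynomial is a polynomial with complex coefficients in $E,F$ and their $x$-derivatives. For a differential polynomial $P$ that is a total $x$-derivative of a differential polynomial, $\int P\,dx$ denotes the unique antiderivative that is a differential polynomial with zero constant term (constants of integration are zero), afterwards evaluated at the given functions. That the integrands in the formula for $\mathcal H_n$ are total derivatives is part of the assertion. Normalized NLS solitons: $A_{-1}=0$, $A_0=2$, and for $k\ge1$ $$A_k=\frac12\int\big[\langle E,A_{k-1}\rangle+\langle F,A_{k-2}\rangle\big]dx-\frac14A_{k-2}''$$ (the required antiderivatives exist as differential polynomials for all $k$; in particular $A_{n+1}$ is defined). For example $A_1=E$, $A_2=\frac34E^2+F$. The normalized NLS $n$-soliton is $\phi_n:=\sum_{k=0}^nA_k\lambda^{n-k}$, defined by this recursion. *)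

theory Defs
  imports "HOL-Analysis.Analysis" "HOL-Library.Poly_Mapping"
    "HOL-Computational_Algebra.Polynomial"
begin

section \<open>Differential polynomials in two differential indeterminates\<close>

text \<open>\<open>Ejet j\<close> and \<open>Fjet j\<close> are the indeterminates for the \<open>j\<close>-th \<open>x\<close>-derivatives of
  \<open>E\<close> and \<open>F\<close>. A monomial is a finitely supported exponent vector on these indeterminates,
  and the product on \<^typ>\<open>('a \<Rightarrow>\<^sub>0 nat) \<Rightarrow>\<^sub>0 complex\<close> is convolution,
  that is, multiplication of polynomials.\<close>

datatype jet = Ejet nat | Fjet nat

fun jet_shift :: "jet \<Rightarrow> jet" where
  "jet_shift (Ejet j) = Ejet (Suc j)"
| "jet_shift (Fjet j) = Fjet (Suc j)"

type_synonym diff_poly = "(jet \<Rightarrow>\<^sub>0 nat) \<Rightarrow>\<^sub>0 complex"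

definition dconst :: "complex \<Rightarrow> diff_poly" where
  "dconst c = Poly_Mapping.single 0 c"

definition dvar :: "jet \<Rightarrow> diff_poly" where
  "dvar v = Poly_Mapping.single (Poly_Mapping.single v 1) 1"

abbreviation dE :: diff_poly where "dE \<equiv> dvar (Ejet 0)"
abbreviation dF :: diff_poly where "dF \<equiv> dvar (Fjet 0)"

text \<open>The total \<open>x\<close>-derivative, \<open>P \<mapsto> \<Sum>\<^sub>v (\<partial>P/\<partial>v) \<cdot> v'\<close>, written out on monomials.\<close>

definition tderiv :: "diff_poly \<Rightarrow> diff_poly" where
  "tderiv P = (\<Sum>m\<in>Poly_Mapping.keys P. \<Sum>v\<in>Poly_Mapping.keys m.
     Poly_Mapping.single (m - Poly_Mapping.single v 1 + Poly_Mapping.single (jet_shift v) 1)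
       (Poly_Mapping.lookup P m * of_nat (Poly_Mapping.lookup m v)))"

text \<open>The antiderivative is only meaningful on total derivatives, that is, on \<open>range tderiv\<close>;
  there it is unique because the kernel of the total derivative consists of the constants.\<close>

definition tint :: "diff_poly \<Rightarrow> diff_poly" where
  "tint P = (THE Q. tderiv Q = P \<and> Poly_Mapping.lookup Q 0 = 0)"

definition bil :: "diff_poly \<Rightarrow> diff_poly \<Rightarrow> diff_poly" where
  "bil \<psi> \<phi> = tderiv \<psi> * \<phi> + 2 * \<psi> * tderiv \<phi>"

section \<open>Coefficients of the normalized NLS solitons\<close>

text \<open>\<open>if k = 0 then 0 else solA (k - 1)\<close> encodes the convention \<open>A\<^sub>-\<^sub>1 = 0\<close>.\<close>

fun solA :: "nat \<Rightarrow> diff_poly" where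
  "solA 0 = 2"
| "solA (Suc k) =
     dconst (1/2) * tint (bil dE (solA k) + bil dF (if k = 0 then 0 else solA (k - 1)))
     - dconst (1/4) * tderiv (tderiv (if k = 0 then 0 else solA (k - 1)))"

definition solB :: "nat \<Rightarrow> diff_poly" where
  "solB n = tderiv (tderiv (tderiv (solA n))) - 2 * bil dF (solA n)"

section \<open>Functions of a real variable, and evaluation of differential polynomials\<close>

definition dx :: "(real \<Rightarrow> complex) \<Rightarrow> real \<Rightarrow> complex" where
  "dx f x = vector_derivative f (at x)"

definition smooth_on :: "real set \<Rightarrow> (real \<Rightarrow> complex) \<Rightarrow> bool" where
  "smooth_on I f \<longleftrightarrow> (\<forall>k. \<forall>x\<in>I. ((dx ^^ k) f) differentiable (at x))"

fun jet_val :: "(real \<Rightarrow> complex) \<Rightarrow> (real \<Rightarrow> complex) \<Rightarrow> real \<Rightarrow> jet \<Rightarrow> complex" where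
  "jet_val E F x (Ejet j) = (dx ^^ j) E x"
| "jet_val E F x (Fjet j) = (dx ^^ j) F x"

definition deval :: "(real \<Rightarrow> complex) \<Rightarrow> (real \<Rightarrow> complex) \<Rightarrow> diff_poly \<Rightarrow> real \<Rightarrow> complex" where
  "deval E F P x = (\<Sum>m\<in>Poly_Mapping.keys P. Poly_Mapping.lookup P m *
     (\<Prod>v\<in>Poly_Mapping.keys m. jet_val E F x v ^ Poly_Mapping.lookup m v))"

section \<open>Polynomials in the spectral parameter\<close>

text \<open>A polynomial in \<open>\<lambda>\<close> whose coefficients are functions of \<open>x\<close> is a function
  \<^typ>\<open>real \<Rightarrow> complex poly\<close>, so identities between such polynomials hold
  coefficientwise. The \<open>x\<close>-derivative acts on the coefficients; \<^const>\<open>Abs_poly\<close> is harmless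
  for families of bounded degree, which is the only use below.\<close>

definition dx_poly :: "(real \<Rightarrow> complex poly) \<Rightarrow> real \<Rightarrow> complex poly" where
  "dx_poly \<phi> x = Abs_poly (\<lambda>k. dx (\<lambda>y. coeff (\<phi> y) k) x)"

definition soliton ::
  "(real \<Rightarrow> complex) \<Rightarrow> (real \<Rightarrow> complex) \<Rightarrow> nat \<Rightarrow> real \<Rightarrow> complex poly" where
  "soliton E F n x = (\<Sum>k=0..n. monom (deval E F (solA k) x) (n - k))"

definition Lhat :: "(real \<Rightarrow> complex) \<Rightarrow> (real \<Rightarrow> complex) \<Rightarrow> real \<Rightarrow> complex poly" where
  "Lhat E F x = - monom 1 2 + monom (E x) 1 + monom (F x) 0"

definition calH ::
  "(real \<Rightarrow> complex) \<Rightarrow> (real \<Rightarrow> complex) \<Rightarrow> nat \<Rightarrow> real \<Rightarrow> complex poly" where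
  "calH E F n x = (let \<phi> = soliton E F n in
     \<phi> x * dx_poly (dx_poly \<phi>) x - smult (1/2) ((dx_poly \<phi> x)\<^sup>2) - 2 * Lhat E F x * (\<phi> x)\<^sup>2)"

definition nlsE :: "(real \<Rightarrow> complex) \<Rightarrow> real \<Rightarrow> complex" where
  "nlsE q x = \<i> * dx q x / q x"

definition nlsF :: "real \<Rightarrow> (real \<Rightarrow> complex) \<Rightarrow> real \<Rightarrow> complex" where
  "nlsF \<sigma> q x = - (1/4) * (nlsE q x)\<^sup>2 - of_real (\<sigma> * (cmod (q x))\<^sup>2) + (\<i>/2) * dx (nlsE q) x"

end

theory Submission
  imports Defs
begin

text \<open>Let \<open>L = - \<lambda>\<^sup>2 + E \<lambda> + F\<close>. For every polynomial \<open>\<phi>\<close> in \<open>\<lambda>\<close> the expression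
\<open>H = \<phi> \<phi>'' - \<phi>'\<^sup>2 / 2 - 2 L \<phi>\<^sup>2\<close> satisfies \<open>H' = \<phi> (\<phi>''' - 2 \<langle>L, \<phi>\<rangle>)\<close>. The recursion for the
\<open>A\<^sub>k\<close> is what makes the second factor small for the soliton: all its coefficients cancel except
the two lowest, and \<open>\<phi>\<^sub>n''' - 2 \<langle>L, \<phi>\<^sub>n\<rangle> = B\<^sub>n - 4 A\<^bsub>n+1\<^esub>' \<lambda>\<close>
(lemma \<open>defect_solpoly\<close>). Hence \<open>H\<^sub>n' = \<phi>\<^sub>n (B\<^sub>n - 4 A\<^bsub>n+1\<^esub>' \<lambda>)\<close>, whose coefficients below degree
\<open>n + 1\<close> are the integrands of the theorem; in particular these are total derivatives.

A differential polynomial is determined by its derivative and its constant term, since only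
constants have derivative zero (lemma \<open>tderiv_eq_0_imp_const\<close>). The constant term is the value at
\<open>E = F = 0\<close>, where \<open>\<phi>\<^sub>n\<close> becomes \<open>2 \<lambda>\<^sup>n\<close> and \<open>H\<^sub>n\<close> becomes \<open>8 \<lambda>\<^bsup>2n+2\<^esup>\<close>. So every coefficient of
\<open>H\<^sub>n\<close> is the normalized antiderivative of its derivative, up to the single constant \<open>8\<close> in
degree \<open>2n + 2\<close> (lemma \<open>coeff_Hpoly_solpoly\<close>).

The same identity proves that the recursion can be carried out, that is, that each of its
integrands is a total derivative (lemma \<open>sol_integrand_step\<close>): the coefficient of \<open>\<lambda>\<^bsup>n+1\<^esup>\<close>
in \<open>H\<^sub>n'\<close> is \<open>A\<^sub>0 = 2\<close> times the linear term of the second factor, in which the integrand for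
\<open>A\<^bsub>n+1\<^esub>\<close> appears together with a manifest derivative.

All this is algebra in the ring of differential polynomials. It is transported to functions by
evaluation at \<open>E\<close> and \<open>F\<close>, a ring homomorphism that turns the total derivative into \<open>d/dx\<close>
when \<open>E\<close> and \<open>F\<close> are smooth, and these are smooth because \<open>q\<close> is smooth and has no
zero.\<close>

section \<open>The total derivative as a derivation, and its kernel\<close>

abbreviation coef :: "('a \<Rightarrow>\<^sub>0 'b::zero) \<Rightarrow> 'a \<Rightarrow> 'b" where "coef \<equiv> Poly_Mapping.lookup"
abbreviation mon :: "'a \<Rightarrow> 'b \<Rightarrow> ('a \<Rightarrow>\<^sub>0 'b::zero)" where "mon \<equiv> Poly_Mapping.single"
abbreviation cterm :: "diff_poly \<Rightarrow> complex" where "cterm P \<equiv> Poly_Mapping.lookup P 0"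
abbreviation supp :: "('a \<Rightarrow>\<^sub>0 'b::zero) \<Rightarrow> 'a set" where "supp \<equiv> Poly_Mapping.keys"

lemma poly_mapping_expand: "P = (\<Sum>m\<in>supp P. mon m (coef P m))" for P :: "('a \<Rightarrow>\<^sub>0 'b::comm_monoid_add)"
  by (rule poly_mapping_eqI) (auto simp: lookup_sum lookup_single when_def in_keys_iff)

text \<open>Used both for differential polynomials and, one level down, for their exponent vectors.\<close>

lemma poly_mapping_additive_induct:
  fixes P :: "('a \<Rightarrow>\<^sub>0 'b::comm_monoid_add)"
  assumes "R 0" "\<And>m c. R (mon m c)" "\<And>P Q. R P \<Longrightarrow> R Q \<Longrightarrow> R (P + Q)"
  shows "R P"
proof -
  have "finite S \<Longrightarrow> R (\<Sum>m\<in>S. mon m (coef P m))" for S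
    by (induction S rule: finite_induct) (auto intro: assms)
  thus ?thesis
    using poly_mapping_expand[of P] by (metis finite_keys)
qed

text \<open>Separating the exponent vector from its coefficient writes the total derivative
as a sum of terms linear in the coefficients, so that additivity is immediate.\<close>

definition tderiv_monomial :: "(jet \<Rightarrow>\<^sub>0 nat) \<Rightarrow> diff_poly" where
  "tderiv_monomial m = (\<Sum>v\<in>supp m. mon (m - mon v 1 + mon (jet_shift v) 1) (of_nat (coef m v)))"

lemma tderiv_alt: "tderiv P = (\<Sum>m\<in>supp P. dconst (coef P m) * tderiv_monomial m)"
  by (simp add: tderiv_def tderiv_monomial_def dconst_def sum_distrib_left mult_single)

lemma dconst_0 [simp]: "dconst 0 = 0" and dconst_1 [simp]: "dconst 1 = 1"
  and dconst_numeral [simp]: "dconst (numeral k) = numeral k"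
  by (simp_all add: dconst_def)
lemma dconst_add: "dconst (a + b) = dconst a + dconst b"
  and dconst_mult: "dconst (a * b) = dconst a * dconst b"
  by (simp_all add: dconst_def single_add mult_single)

lemma tderiv_add: "tderiv (P + Q) = tderiv P + tderiv Q"
  unfolding tderiv_alt
  by (rule setsum_keys_plus_distrib) (simp_all add: dconst_add algebra_simps)

lemma tderiv_0 [simp]: "tderiv 0 = 0"
  by (simp add: tderiv_def)

lemma tderiv_mon: "tderiv (mon m c) = dconst c * tderiv_monomial m"
  by (simp add: tderiv_alt)

lemma tderiv_const [simp]: "tderiv (dconst c) = 0"
  by (simp add: dconst_def tderiv_def)

text \<open>Exponents add under multiplication, so each jet of the product splits its
multiplicity between the two factors.\<close>

lemma tderiv_monomial_add:
  "tderiv_monomial (m + n) = tderiv_monomial m * mon n 1 + mon m 1 * tderiv_monomial n"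
proof -
  let ?t = "\<lambda>m v. mon (m - mon v 1 + mon (jet_shift v) 1) (of_nat (coef m v) :: complex)"
  define S where "S = supp m \<union> supp n"
  have alt: "tderiv_monomial k = (\<Sum>v\<in>S. ?t k v)" if "supp k \<subseteq> S" for k
    unfolding tderiv_monomial_def by (rule sum.mono_neutral_left) (use that in \<open>auto simp: S_def in_keys_iff\<close>)
  \<comment> \<open>Subtraction of exponent vectors is truncated, hence the hypothesis that \<open>v\<close> occurs.\<close>
  have minus: "k - mon v 1 + mon w 1 + l = k + l - mon v 1 + mon w 1"
    if "coef k v > 0" for k l :: "jet \<Rightarrow>\<^sub>0 nat" and v w
    using that
    by (intro poly_mapping_eqI) (auto simp: lookup_add lookup_minus lookup_single when_def)
  have "?t (m + n) v = ?t m v * mon n 1 + mon m 1 * ?t n v" for v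
  proof -
    have 1: "?t m v * mon n 1 = mon (m + n - mon v 1 + mon (jet_shift v) 1) (of_nat (coef m v))"
    proof (cases "coef m v > 0")
      case True
      show ?thesis unfolding mult_single minus[OF True] by simp
    qed simp
    have 2: "mon m 1 * ?t n v = mon (m + n - mon v 1 + mon (jet_shift v) 1) (of_nat (coef n v))"
    proof (cases "coef n v > 0")
      case True
      show ?thesis unfolding mult_single add.commute[of m] minus[OF True] by simp
    qed simp
    show ?thesis unfolding 1 2 by (simp add: lookup_add single_add)
  qed
  thus ?thesis
    using keys_add[of m n]
    by (simp add: alt S_def sum.distrib sum_distrib_left sum_distrib_right)
qed

lemma tderiv_mult: "tderiv (P * Q) = tderiv P * Q + P * tderiv Q"
proof (induction P rule: poly_mapping_additive_induct)
  case (2 m c)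
  show ?case
  proof (induction Q rule: poly_mapping_additive_induct)
    case (2 n d)
    have scale: "mon k a = dconst a * mon k 1" for k and a :: complex
      by (simp add: dconst_def mult_single)
    show ?case
      unfolding mult_single tderiv_mon tderiv_monomial_add dconst_mult
      by (simp only: scale[of m c] scale[of n d]) (simp add: algebra_simps)
  qed (simp_all add: algebra_simps tderiv_add)
qed (simp_all add: algebra_simps tderiv_add)

lemma tderiv_minus: "tderiv (- P) = - tderiv P"
  using tderiv_add[of P "- P"] by (simp add: eq_neg_iff_add_eq_0 add.commute)
lemma tderiv_diff: "tderiv (P - Q) = tderiv P - tderiv Q"
  using tderiv_add[of P "- Q"] by (simp add: tderiv_minus)

lemma tderiv_numeral [simp]: "tderiv (numeral k) = 0" "tderiv 1 = 0"
  using tderiv_const[of "numeral k"] tderiv_const[of 1] by simp_all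

fun jet_order :: "jet \<Rightarrow> nat" where
  "jet_order (Ejet j) = j" | "jet_order (Fjet j) = j"

lemma jet_order_shift [simp]: "jet_order (jet_shift v) = Suc (jet_order v)" by (cases v) auto
lemma jet_shift_inj: "jet_shift v = jet_shift w \<Longrightarrow> v = w" by (cases v; cases w) auto

text \<open>A nonconstant differential polynomial has a nonzero derivative because differentiating its
highest jet produces a jet of still higher order, which occurs in no other way. This makes
\<^const>\<open>tint\<close> well defined.\<close>

lemma tderiv_eq_0_imp_const:
  assumes D: "tderiv P = 0"
  shows "P = dconst (cterm P)"
proof (rule ccontr)
  assume neq: "P \<noteq> dconst (cterm P)"
  \<comment> \<open>\<open>V\<close> is the finite set of jets occurring in \<open>P\<close>. A jet \<open>v\<close> of maximal order in it has a derivative that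
    is new, so a monomial \<open>m\<close> containing \<open>v\<close> leaves a trace \<open>m'\<close> that nothing else can cancel.\<close>
  define V where "V = (\<Union>m\<in>supp P. supp m)"
  have "V \<noteq> {}"
  proof
    assume "V = {}"
    hence "supp P \<subseteq> {0}" by (auto simp: V_def)
    hence "P = dconst (cterm P)"
      by (intro poly_mapping_eqI) (auto simp: dconst_def lookup_single when_def in_keys_iff)
    with neq show False ..
  qed
  have "finite V" by (simp add: V_def)
  define N where "N = Max (jet_order ` V)"
  have "N \<in> jet_order ` V" using \<open>finite V\<close> \<open>V \<noteq> {}\<close> by (simp add: N_def)
  then obtain v where v: "v \<in> V" "jet_order v = N" by auto
  have new: "jet_shift v \<notin> V"
  proof
    assume "jet_shift v \<in> V"
    hence "jet_order (jet_shift v) \<le> N"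
      unfolding N_def using \<open>finite V\<close> by (intro Max_ge imageI) auto
    with v show False by simp
  qed
  from v obtain m where m: "m \<in> supp P" "v \<in> supp m" by (auto simp: V_def)
  define m' where "m' = m - mon v 1 + mon (jet_shift v) 1"
  have hit: "k = m \<and> w = v"
    if k: "k \<in> supp P" "w \<in> supp k" and eq: "k - mon w 1 + mon (jet_shift w) 1 = m'" for k w
  proof
    have "coef k (jet_shift v) = 0" using k(1) new by (auto simp: V_def in_keys_iff)
    with eq[THEN arg_cong, of "\<lambda>k. coef k (jet_shift v)"]
    have "jet_shift w = jet_shift v"
      by (auto simp: m'_def lookup_add lookup_minus lookup_single when_def split: if_splits)
    thus w: "w = v" by (rule jet_shift_inj)
    with eq have *: "k - mon v 1 = m - mon v 1" by (simp add: m'_def)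
    show "k = m"
    proof (rule poly_mapping_eqI)
      fix u
      from *[THEN arg_cong, of "\<lambda>k. coef k u"] k(2) m(2) w show "coef k u = coef m u"
        by (auto simp: lookup_minus lookup_single when_def in_keys_iff split: if_splits)
    qed
  qed
  have "coef (tderiv P) m' = (\<Sum>k\<in>supp P. \<Sum>w\<in>supp k.
      if k = m \<and> w = v then coef P m * of_nat (coef m v) else 0)"
    unfolding tderiv_def lookup_sum lookup_single when_def
    by (intro sum.cong refl) (use hit in \<open>auto simp: m'_def\<close>)
  also have "\<dots> = (\<Sum>k\<in>supp P. if k = m then coef P m * of_nat (coef m v) else 0)"
    by (intro sum.cong refl) (use m in \<open>auto simp: if_distrib\<close>)
  also have "\<dots> = coef P m * of_nat (coef m v)" using m by simp
  finally show False using D m by (simp add: in_keys_iff)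
qed

section \<open>Evaluation of differential polynomials at functions\<close>

definition jet_monomial_val :: "(real \<Rightarrow> complex) \<Rightarrow> (real \<Rightarrow> complex) \<Rightarrow> real \<Rightarrow> (jet \<Rightarrow>\<^sub>0 nat) \<Rightarrow> complex" where
  "jet_monomial_val E F x m = (\<Prod>v\<in>supp m. jet_val E F x v ^ coef m v)"

lemma deval_alt: "deval E F P x = (\<Sum>m\<in>supp P. coef P m * jet_monomial_val E F x m)"
  by (simp add: deval_def jet_monomial_val_def)

lemma deval_add: "deval E F (P + Q) x = deval E F P x + deval E F Q x"
  unfolding deval_alt by (rule setsum_keys_plus_distrib) (simp_all add: algebra_simps)

lemma deval_mon: "deval E F (mon m c) x = c * jet_monomial_val E F x m"
  by (simp add: deval_alt)

lemma deval_0 [simp]: "deval E F 0 x = 0" by (simp add: deval_def)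

lemma jet_monomial_val_add: "jet_monomial_val E F x (m + n) = jet_monomial_val E F x m * jet_monomial_val E F x n"
proof -
  define S where "S = supp m \<union> supp n"
  have alt: "jet_monomial_val E F x k = (\<Prod>v\<in>S. jet_val E F x v ^ coef k v)" if "supp k \<subseteq> S" for k
    unfolding jet_monomial_val_def by (rule prod.mono_neutral_left) (use that in \<open>auto simp: S_def in_keys_iff\<close>)
  show ?thesis using keys_add[of m n]
    by (simp add: alt S_def lookup_add power_add prod.distrib)
qed

lemma deval_mult: "deval E F (P * Q) x = deval E F P x * deval E F Q x"
proof (induction P rule: poly_mapping_additive_induct)
  case (2 m c)
  show ?case
    by (induction Q rule: poly_mapping_additive_induct)
       (simp_all add: mult_single deval_mon jet_monomial_val_add deval_add algebra_simps)
qed (simp_all add: deval_add algebra_simps)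

lemma deval_dconst [simp]: "deval E F (dconst c) x = c"
  by (simp add: dconst_def deval_mon jet_monomial_val_def)
lemma deval_dvar [simp]: "deval E F (dvar v) x = jet_val E F x v"
  by (simp add: dvar_def deval_mon jet_monomial_val_def)

lemma tderiv_dvar [simp]: "tderiv (dvar v) = dvar (jet_shift v)"
  by (simp add: dvar_def tderiv_mon tderiv_monomial_def)

text \<open>Statements about evaluation that respect the ring operations need only be checked on constants
and single jets.\<close>

lemma diff_poly_induct [case_names const var add mult]:
  assumes const: "\<And>c. R (dconst c)" and var: "\<And>v. R (dvar v)"
    and add: "\<And>P Q. R P \<Longrightarrow> R Q \<Longrightarrow> R (P + Q)"
    and mult: "\<And>P Q. R P \<Longrightarrow> R Q \<Longrightarrow> R (P * Q)"
  shows "R P"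
proof (induction P rule: poly_mapping_additive_induct)
  case 1
  show ?case using const[of 0] by simp
next
  case (2 m c)
  have "R (mon m 1)"
  proof (induction m rule: poly_mapping_additive_induct)
    case 1
    show ?case using const[of 1] by simp
  next
    case (2 v k)
    show ?case
    proof (induction k)
      case 0
      show ?case using const[of 1] by simp
    next
      case (Suc k)
      have "mon (mon v (Suc k)) 1 = dvar v * mon (mon v k) 1"
        by (simp add: dvar_def mult_single single_add[symmetric])
      with mult[OF var Suc] show ?case by simp
    qed
  next
    case (3 m n)
    have "mon (m + n) 1 = mon m 1 * mon n (1::complex)" by (simp add: mult_single)
    with mult[OF 3] show ?case by simp
  qed
  moreover have "mon m c = dconst c * mon m 1" by (simp add: dconst_def mult_single)
  ultimately show ?case using const mult by metis
qed (rule add)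

text \<open>The formal total derivative models \<open>d/dx\<close>: both are derivations and they agree on each jet.
Differentiability of every jet is exactly what smoothness of \<open>E\<close> and \<open>F\<close> supplies.\<close>

lemma deval_has_vector_derivative:
  assumes sm: "smooth_on I E" "smooth_on I F" and x: "x \<in> I"
  shows "(deval E F P has_vector_derivative deval E F (tderiv P) x) (at x)"
proof (induction P rule: diff_poly_induct)
  case (const c)
  show ?case by (auto intro!: derivative_eq_intros simp: fun_eq_iff deval_dconst[abs_def])
next
  case (var v)
  have "((\<lambda>y. jet_val E F y v) has_vector_derivative jet_val E F x (jet_shift v)) (at x)"
    using sm x by (cases v) (auto simp: smooth_on_def dx_def simp flip: vector_derivative_works)
  thus ?case by (simp add: deval_dvar[abs_def])
next
  case (add P Q)
  show ?case using has_vector_derivative_add[OF add]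
    by (simp add: deval_add[abs_def] tderiv_add)
next
  case (mult P Q)
  show ?case using has_vector_derivative_mult[OF mult]
    by (simp add: deval_mult[abs_def] tderiv_mult deval_add deval_mult add.commute)
qed

lemma dx_funpow_0: "(dx ^^ k) (\<lambda>_. 0) = (\<lambda>_. 0)"
  by (induction k) (simp_all add: dx_def[abs_def])

text \<open>Reading the constant term as the value at \<open>E = F = 0\<close> gives for free that it is a ring
homomorphism and that it kills total derivatives, since a constant function of \<open>x\<close> has
derivative zero.\<close>

lemma cterm_eq_deval: "cterm P = deval (\<lambda>_. 0) (\<lambda>_. 0) P x"
proof -
  have j: "jet_val (\<lambda>_. 0) (\<lambda>_. 0) x v = 0" for v by (cases v) (simp_all add: dx_funpow_0)
  have *: "jet_monomial_val (\<lambda>_. 0) (\<lambda>_. 0) x m = (if m = 0 then 1 else 0)" for m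
    by (auto simp: jet_monomial_val_def j in_keys_iff intro: poly_mapping_eqI)
  show ?thesis unfolding deval_alt * by (simp add: if_distrib in_keys_iff cong: if_cong)
qed

lemma cterm_mult: "cterm (P * Q) = cterm P * cterm Q"
  by (simp add: cterm_eq_deval[of _ 0] deval_mult)

lemma cterm_tderiv [simp]: "cterm (tderiv P) = 0"
proof -
  have "((\<lambda>x::real. cterm P) has_vector_derivative cterm (tderiv P)) (at 0)"
    using deval_has_vector_derivative[of UNIV "\<lambda>_. 0" "\<lambda>_. 0" 0 P]
    by (simp add: smooth_on_def dx_funpow_0 cterm_eq_deval[symmetric, abs_def])
  moreover have "((\<lambda>x::real. cterm P) has_vector_derivative 0) (at 0)" by simp
  ultimately show ?thesis by (rule vector_derivative_unique_at)
qed

section \<open>Normalized antiderivatives\<close>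

lemma tint_eq:
  assumes "tderiv Q = P" "cterm Q = 0"
  shows "tint P = Q"
  unfolding tint_def
proof (rule the_equality)
  fix Q' assume Q': "tderiv Q' = P \<and> cterm Q' = 0"
  hence "tderiv (Q' - Q) = 0" using assms by (simp add: tderiv_diff)
  from tderiv_eq_0_imp_const[OF this] show "Q' = Q" using assms Q' by (simp add: lookup_minus)
qed (use assms in auto)

text \<open>Integration recovers everything but the constant term. Together with a computation of constant
terms, this determines a differential polynomial from its derivative.\<close>

lemma tint_tderiv: "tint (tderiv Q) = Q - dconst (cterm Q)"
  by (rule tint_eq) (simp_all add: tderiv_diff lookup_minus, simp add: dconst_def)

lemma tderiv_tint: "P \<in> range tderiv \<Longrightarrow> tderiv (tint P) = P"
  by (auto simp: tint_tderiv tderiv_diff)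

lemma cterm_tint: "P \<in> range tderiv \<Longrightarrow> cterm (tint P) = 0"
  by (auto simp: tint_tderiv lookup_minus dconst_def)

section \<open>Polynomials in the spectral parameter and the first integral\<close>

text \<open>Polynomials in \<open>\<lambda>\<close> are taken over the ring of differential polynomials, and the derivation is
extended with \<open>\<lambda>\<close> as a constant. It is again a derivation, so identities in \<open>\<phi>\<close> can be proved
by ring calculations without double sums of coefficients.\<close>

definition tderiv_poly :: "diff_poly poly \<Rightarrow> diff_poly poly" where
  "tderiv_poly = map_poly tderiv"

lemma coeff_tderiv_poly [simp]: "coeff (tderiv_poly p) k = tderiv (coeff p k)"
  by (simp add: tderiv_poly_def coeff_map_poly)

lemma tderiv_sum: "tderiv (sum f A) = (\<Sum>a\<in>A. tderiv (f a))"
  by (induction A rule: infinite_finite_induct) (simp_all add: tderiv_add)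

lemma tderiv_poly_add: "tderiv_poly (p + q) = tderiv_poly p + tderiv_poly q"
  and tderiv_poly_diff: "tderiv_poly (p - q) = tderiv_poly p - tderiv_poly q"
  and tderiv_poly_mult: "tderiv_poly (p * q) = tderiv_poly p * q + p * tderiv_poly q"
  by (simp_all add: poly_eq_iff tderiv_add tderiv_diff coeff_mult tderiv_sum tderiv_mult sum.distrib)

lemma tderiv_poly_pCons [simp]: "tderiv_poly (pCons a p) = pCons (tderiv a) (tderiv_poly p)"
  by (simp add: tderiv_poly_def map_poly_pCons)
lemma tderiv_poly_0 [simp]: "tderiv_poly 0 = 0" by (simp add: tderiv_poly_def)
lemma tderiv_poly_numeral [simp]: "tderiv_poly (numeral k) = 0"
  unfolding numeral_poly by simp

definition Lpoly :: "diff_poly poly" where "Lpoly = [:dF, dE, -1:]"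

text \<open>The formal counterpart of \<^const>\<open>calH\<close>, for an arbitrary \<open>\<phi>\<close> in place of the soliton.\<close>

definition Hpoly :: "diff_poly poly \<Rightarrow> diff_poly poly" where
  "Hpoly p = p * tderiv_poly (tderiv_poly p) - [:dconst (1/2):] * (tderiv_poly p)\<^sup>2 - 2 * Lpoly * p\<^sup>2"

text \<open>The expression \<open>\<phi>''' - 2 \<langle>L, \<phi>\<rangle>\<close>. The recursion for the \<open>A\<^sub>k\<close> says that the formal series
\<open>\<Sum> A\<^sub>k \<lambda>\<^sup>-\<^sup>k\<close> has defect zero; the defect of a truncation is what the truncation costs.\<close>

definition defect :: "diff_poly poly \<Rightarrow> diff_poly poly" where
  "defect p = tderiv_poly (tderiv_poly (tderiv_poly p)) - 2 * (tderiv_poly Lpoly * p + 2 * Lpoly * tderiv_poly p)"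

lemma dconst_half: "dconst (1/2) * 2 = 1" "2 * dconst (1/2) = 1" and dconst_quarter: "dconst (1/4) * 4 = 1"
  using dconst_mult[of "1/2" 2, symmetric] dconst_mult[of 2 "1/2", symmetric] dconst_mult[of "1/4" 4, symmetric] by simp_all

text \<open>The first integral behind the whole argument: \<open>\<phi>\<close> is an integrating factor of the third-order
expression, and \<open>H\<close> is the resulting integral.\<close>

lemma tderiv_poly_Hpoly: "tderiv_poly (Hpoly p) = p * defect p"
proof -
  \<comment> \<open>Kept opaque, so that simplification does not expand products with the constant polynomial; only
    \<open>h * 2 = 1\<close> and \<open>h' = 0\<close> matter.\<close>
  define h where "h = [:dconst (1/2):]"
  have h: "h * 2 = 1" and [simp]: "tderiv_poly h = 0"
    unfolding h_def numeral_poly by (simp_all add: dconst_half one_pCons)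
  have "tderiv_poly (Hpoly p) = tderiv_poly p * tderiv_poly (tderiv_poly p) + p * tderiv_poly (tderiv_poly (tderiv_poly p))
      - (h * 2) * (tderiv_poly p * tderiv_poly (tderiv_poly p))
      - 2 * (tderiv_poly Lpoly * p\<^sup>2) - 2 * Lpoly * (2 * p * tderiv_poly p)"
    by (simp add: Hpoly_def h_def[symmetric] tderiv_poly_diff tderiv_poly_add tderiv_poly_mult power2_eq_square algebra_simps
        del: mult_pCons_left)
  also have "\<dots> = p * defect p"
    unfolding h by (simp add: defect_def algebra_simps power2_eq_square)
  finally show ?thesis .
qed

text \<open>The defect is linear in \<open>\<phi>\<close> and commutes with multiplication by \<open>\<lambda>\<close>, so passing from \<open>\<phi>\<close> to
\<open>\<lambda> \<phi> + a\<close> only adds the defect of the constant polynomial \<open>a\<close>.\<close>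

lemma defect_pCons:
  "defect (pCons a p) = pCons 0 (defect p)
     + [:tderiv (tderiv (tderiv a)) - 2 * bil dF a, - 2 * bil dE a, 4 * tderiv a:]"
proof -
  have "defect (pCons a p) = defect (pCons 0 p) + defect [:a:]"
  proof -
    have "pCons a p = pCons 0 p + [:a:]" by simp
    thus ?thesis unfolding defect_def by (simp only: tderiv_poly_add) (simp add: algebra_simps)
  qed
  moreover have "defect (pCons 0 p) = pCons 0 (defect p)"
  proof -
    \<comment> \<open>Multiplication by \<open>\<lambda>\<close>, which commutes with the \<open>x\<close>-derivative.\<close>
    define X where "X = [:0, 1 :: diff_poly:]"
    have e: "pCons 0 q = X * q" for q by (simp add: X_def)
    have "tderiv_poly X = 0" by (simp add: X_def)
    thus ?thesis unfolding e defect_def by (simp add: tderiv_poly_mult algebra_simps)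
  qed
  moreover have "defect [:a:] = [:tderiv (tderiv (tderiv a)) - 2 * bil dF a, - 2 * bil dE a, 4 * tderiv a:]"
    unfolding defect_def Lpoly_def bil_def numeral_poly
    by (simp add: algebra_simps tderiv_minus)
  ultimately show ?thesis by simp
qed

section \<open>Solvability of the recursion and the defect of the soliton\<close>

definition solA_prev :: "nat \<Rightarrow> diff_poly" where
  "solA_prev k = (if k = 0 then 0 else solA (k - 1))"

definition sol_integrand :: "nat \<Rightarrow> diff_poly" where
  "sol_integrand k = bil dE (solA k) + bil dF (solA_prev k)"

lemma solA_Suc: "solA (Suc k) = dconst (1/2) * tint (sol_integrand k) - dconst (1/4) * tderiv (tderiv (solA_prev k))"
  by (simp add: sol_integrand_def solA_prev_def)

declare solA.simps(2) [simp del]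

text \<open>The formal soliton by the Horner scheme \<open>\<phi>\<^bsub>n+1\<^esub> = \<lambda> \<phi>\<^sub>n + A\<^bsub>n+1\<^esub>\<close>, which is the form that
an induction on the defect can use.\<close>

fun solpoly :: "nat \<Rightarrow> diff_poly poly" where
  "solpoly 0 = [:2:]"
| "solpoly (Suc n) = pCons (solA (Suc n)) (solpoly n)"

lemma coeff_solpoly: "coeff (solpoly n) j = (if j \<le> n then solA (n - j) else 0)"
  by (induction n arbitrary: j) (auto simp: coeff_pCons split: nat.split)

lemma tderiv_dconst_mult: "tderiv (dconst c * P) = dconst c * tderiv P"
  by (simp add: tderiv_mult)

lemma tderiv_solA_Suc:
  assumes "sol_integrand k \<in> range tderiv"
  shows "4 * tderiv (solA (Suc k)) = 2 * sol_integrand k - tderiv (tderiv (tderiv (solA_prev k)))"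
proof -
  have "4 * tderiv (solA (Suc k)) = (dconst (1/2) * 2) * (2 * sol_integrand k) 
      - (dconst (1/4) * 4) * tderiv (tderiv (tderiv (solA_prev k)))"
    unfolding solA_Suc tderiv_diff tderiv_dconst_mult tderiv_tint[OF assms]
    by (simp add: algebra_simps)
  thus ?thesis by (simp add: dconst_half dconst_quarter)
qed

text \<open>Why the antiderivatives exist: if all earlier steps of the recursion are solved, the defect of
\<open>\<phi>\<^sub>n\<close> has degree at most one in \<open>\<lambda>\<close>, with the next integrand in the linear term. Comparing
coefficients of \<open>\<lambda>\<^bsup>n+1\<^esup>\<close> in \<open>H' = \<phi>\<^sub>n \<cdot> defect\<close> picks out this linear term multiplied by the
constant \<open>A\<^sub>0 = 2\<close>, and so exhibits the integrand as a total derivative.\<close>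

lemma sol_integrand_step:
  assumes "defect (solpoly n) = [:solB n, tderiv (tderiv (tderiv (solA_prev n))) - 2 * sol_integrand n:]"
  shows "sol_integrand n \<in> range tderiv"
proof -
  let ?c = "coeff (Hpoly (solpoly n)) (Suc n)" and ?d = "tderiv (tderiv (solA_prev n))"
  have "tderiv ?c = coeff (solpoly n * defect (solpoly n)) (Suc n)"
    by (simp flip: tderiv_poly_Hpoly)
  \<comment> \<open>The coefficient of \<open>solpoly n\<close> at \<open>n + 1\<close> is zero and that at \<open>n\<close> is \<open>A\<^sub>0 = 2\<close>.\<close>
  also have "\<dots> = 2 * (tderiv ?d - 2 * sol_integrand n)"
    by (simp add: assms mult_pCons_right coeff_solpoly)
  finally have "4 * sol_integrand n = tderiv (2 * ?d - ?c)"
    by (simp add: tderiv_diff tderiv_mult algebra_simps)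
  moreover have "sol_integrand n = dconst (1/4) * 4 * sol_integrand n" by (simp add: dconst_quarter)
  ultimately have "sol_integrand n = tderiv (dconst (1/4) * (2 * ?d - ?c))"
    by (simp add: tderiv_dconst_mult mult.assoc)
  thus ?thesis by blast
qed

text \<open>The defect is written with the integrand rather than with \<open>A\<^bsub>n+1\<^esub>'\<close>, because that the integrand
is integrable is a consequence drawn from this form at each step of the induction.\<close>

lemma defect_solpoly_unintegrated:
  "defect (solpoly n) = [:solB n, tderiv (tderiv (tderiv (solA_prev n))) - 2 * sol_integrand n:]"
proof (induction n)
  case 0
  show ?case using defect_pCons[of 2 0]
    by (simp add: defect_def solB_def sol_integrand_def solA_prev_def bil_def)
next
  case (Suc n)
  \<comment> \<open>The \<open>\<lambda>\<^sup>2\<close>-term vanishes: it is \<open>\<lambda>\<close> times the old linear term plus the new \<open>4 A\<^bsub>n+1\<^esub>' \<lambda>\<^sup>2\<close>.\<close>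
  have "tderiv (tderiv (tderiv (solA_prev n))) - 2 * sol_integrand n + 4 * tderiv (solA (Suc n)) = 0"
    using tderiv_solA_Suc[OF sol_integrand_step[OF Suc]] by simp
  moreover have "solA_prev (Suc n) = solA n" by (simp add: solA_prev_def)
  ultimately show ?case
    by (simp add: defect_pCons Suc solB_def sol_integrand_def[of "Suc n"] algebra_simps)
qed

lemma sol_integrand_in_range: "sol_integrand n \<in> range tderiv"
  by (rule sol_integrand_step[OF defect_solpoly_unintegrated])

lemma defect_solpoly: "defect (solpoly n) = [:solB n, - 4 * tderiv (solA (Suc n)):]"
  using tderiv_solA_Suc[OF sol_integrand_in_range, of n] by (simp add: defect_solpoly_unintegrated)

lemma cterm_solA_Suc: "cterm (solA (Suc k)) = 0"
  by (simp add: solA_Suc lookup_minus cterm_mult cterm_tint[OF sol_integrand_in_range])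

section \<open>The coefficients of the first integral of the soliton\<close>

definition eval_coeffs :: "(real \<Rightarrow> complex) \<Rightarrow> (real \<Rightarrow> complex) \<Rightarrow> real \<Rightarrow> diff_poly poly \<Rightarrow> complex poly" where
  "eval_coeffs E F x = map_poly (\<lambda>P. deval E F P x)"

lemma coeff_eval_coeffs [simp]: "coeff (eval_coeffs E F x p) k = deval E F (coeff p k) x"
  by (simp add: eval_coeffs_def coeff_map_poly)

lemma deval_sum: "deval E F (sum f A) x = (\<Sum>a\<in>A. deval E F (f a) x)"
  by (induction A rule: infinite_finite_induct) (simp_all add: deval_add)
lemma deval_minus: "deval E F (- P) x = - deval E F P x"
  using deval_add[of E F P "- P"] by (simp add: eq_neg_iff_add_eq_0 add.commute)
lemma deval_diff: "deval E F (P - Q) x = deval E F P x - deval E F Q x"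
  using deval_add[of E F P "- Q"] by (simp add: deval_minus)
lemma deval_numeral [simp]: "deval E F (numeral k) x = numeral k" "deval E F 1 x = 1"
  using deval_dconst[of E F "numeral k"] deval_dconst[of E F 1] by simp_all

lemma eval_coeffs_diff: "eval_coeffs E F x (p - q) = eval_coeffs E F x p - eval_coeffs E F x q"
  and eval_coeffs_mult: "eval_coeffs E F x (p * q) = eval_coeffs E F x p * eval_coeffs E F x q"
  by (simp_all add: poly_eq_iff deval_diff coeff_mult deval_sum deval_mult)
lemma eval_coeffs_pCons [simp]: "eval_coeffs E F x (pCons a p) = pCons (deval E F a x) (eval_coeffs E F x p)"
  by (simp add: eval_coeffs_def map_poly_pCons)
lemma eval_coeffs_0 [simp]: "eval_coeffs E F x 0 = 0"
  by (simp add: eval_coeffs_def)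

lemma eval_coeffs_Hpoly:
  "eval_coeffs E F x (Hpoly p) = eval_coeffs E F x p * eval_coeffs E F x (tderiv_poly (tderiv_poly p))
     - smult (1/2) ((eval_coeffs E F x (tderiv_poly p))\<^sup>2) - 2 * Lhat E F x * (eval_coeffs E F x p)\<^sup>2"
proof -
  have "eval_coeffs E F x Lpoly = Lhat E F x"
    by (simp add: Lpoly_def Lhat_def monom_altdef deval_minus power2_eq_square)
  moreover have "eval_coeffs E F x 2 = 2" unfolding numeral_poly by simp
  moreover have "eval_coeffs E F x [:dconst (1/2):] * q = smult (1/2) q" for q by simp
  ultimately show ?thesis
    by (simp only: Hpoly_def eval_coeffs_diff eval_coeffs_mult power2_eq_square)
qed

text \<open>The constants of integration of the coefficients of \<open>H\<^sub>n\<close>, found by evaluating at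
\<open>E = F = 0\<close>.\<close>

lemma cterm_coeff_Hpoly_solpoly:
  "cterm (coeff (Hpoly (solpoly n)) j) = (if j = 2 * n + 2 then 8 else 0)"
proof -
  let ?ev = "eval_coeffs (\<lambda>_. 0) (\<lambda>_. 0) 0"
  \<comment> \<open>At \<open>E = F = 0\<close> only \<open>A\<^sub>0 = 2\<close> survives, all derivatives vanish and \<open>Lhat\<close> is \<open>- \<lambda>\<^sup>2\<close>,
    which leaves \<open>- 2 (- \<lambda>\<^sup>2) (2 \<lambda>\<^sup>n)\<^sup>2\<close>.\<close>
  have 1: "?ev (solpoly n) = monom 2 n"
  proof (rule poly_eqI)
    fix j
    have "cterm (solA k) = (if k = 0 then 2 else 0)" for k
      by (cases k) (simp_all add: cterm_solA_Suc lookup_numeral)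
    moreover have "cterm 2 = 2" by (simp add: lookup_numeral)
    ultimately show "coeff (?ev (solpoly n)) j = coeff (monom 2 n) j"
      by (auto simp: coeff_solpoly simp flip: cterm_eq_deval)
  qed
  have 2: "?ev (tderiv_poly p) = 0" for p
    by (rule poly_eqI) (simp flip: cterm_eq_deval)
  have "?ev (Hpoly (solpoly n)) = monom 8 (2 * n + 2)"
    unfolding eval_coeffs_Hpoly 1 2 by (simp add: Lhat_def power2_eq_square mult_monom numeral_poly smult_monom mult_2)
  hence "coeff (?ev (Hpoly (solpoly n))) j = coeff (monom 8 (2 * n + 2)) j" by simp
  thus ?thesis by (simp flip: cterm_eq_deval)
qed

text \<open>Each coefficient of \<open>H\<^sub>n\<close> is recovered from its derivative and its constant term, in every
degree at once, the leading ones included.\<close>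

lemma coeff_Hpoly_solpoly:
  "coeff (Hpoly (solpoly n)) j =
     tint (coeff (solpoly n * defect (solpoly n)) j)
     + (if j = 2 * n + 2 then 8 else 0)"
proof -
  have "tderiv (coeff (Hpoly (solpoly n)) j) = coeff (solpoly n * defect (solpoly n)) j"
    unfolding tderiv_poly_Hpoly[symmetric] by simp
  thus ?thesis using tint_tderiv[of "coeff (Hpoly (solpoly n)) j"]
    by (auto simp: cterm_coeff_Hpoly_solpoly algebra_simps)
qed

section \<open>Smoothness of the potentials\<close>

lemma dx_eqI: "(f has_vector_derivative d) (at x) \<Longrightarrow> dx f x = d"
  by (simp add: dx_def vector_derivative_at)

lemma dx_cong_open:
  assumes "open I" "x \<in> I" "\<And>y. y \<in> I \<Longrightarrow> f y = g y"
  shows "dx f x = dx g x"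
  unfolding dx_def
  by (rule vector_derivative_cong_eq) (use assms in \<open>auto simp: eventually_nhds intro!: exI[of _ I]\<close>)

lemma has_vector_derivative_inverse:
  fixes f :: "real \<Rightarrow> 'a::real_normed_field"
  assumes "(f has_vector_derivative d) (at x)" "f x \<noteq> 0"
  shows "((\<lambda>y. inverse (f y)) has_vector_derivative - (inverse (f x) * (d * inverse (f x)))) (at x)"
  using Deriv.has_derivative_inverse[OF assms(2) assms(1)[unfolded has_vector_derivative_def]]
  by (simp add: has_vector_derivative_def scaleR_conv_of_real algebra_simps)

text \<open>An algebra of functions that contains everything the coefficients \<open>E\<close> and \<open>F\<close> are built from.
Its members are smooth because the algebra is closed under differentiation on \<open>I\<close>, so that
iterated derivatives stay inside it.\<close>

inductive smooth_closure :: "real set \<Rightarrow> (real \<Rightarrow> complex) \<Rightarrow> bool" for I where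
  base: "smooth_on I f \<Longrightarrow> smooth_closure I f"
| const: "smooth_closure I (\<lambda>_. c)"
| add: "smooth_closure I f \<Longrightarrow> smooth_closure I g \<Longrightarrow> smooth_closure I (\<lambda>x. f x + g x)"
| mult: "smooth_closure I f \<Longrightarrow> smooth_closure I g \<Longrightarrow> smooth_closure I (\<lambda>x. f x * g x)"
| inv: "smooth_closure I f \<Longrightarrow> (\<And>x. x \<in> I \<Longrightarrow> f x \<noteq> 0) \<Longrightarrow> smooth_closure I (\<lambda>x. inverse (f x))"
| cnj: "smooth_closure I f \<Longrightarrow> smooth_closure I (\<lambda>x. cnj (f x))"

lemma smooth_on_dx: "smooth_on I f \<Longrightarrow> smooth_on I (dx f)"
  unfolding smooth_on_def by (metis comp_apply funpow_Suc_right)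

text \<open>The derivative is only claimed to agree on \<open>I\<close> with a member of the algebra, since off \<open>I\<close> the
functions may fail to be differentiable.\<close>

lemma smooth_closure_derivative:
  "smooth_closure I f \<Longrightarrow> \<exists>f'. smooth_closure I f' \<and> (\<forall>x\<in>I. (f has_vector_derivative f' x) (at x))"
proof (induction rule: smooth_closure.induct)
  case (base f)
  have "(f has_vector_derivative dx f x) (at x)" if "x \<in> I" for x
    using base that unfolding smooth_on_def dx_def
    by (metis funpow_0 vector_derivative_works)
  with smooth_closure.base[OF smooth_on_dx[OF base]] show ?case by blast
next
  case (const c)
  show ?case by (rule exI[of _ "\<lambda>_. 0"]) (auto intro: smooth_closure.const)
next
  case (add f g)
  then obtain f' g' where "smooth_closure I f'" "smooth_closure I g'"
    "\<forall>x\<in>I. (f has_vector_derivative f' x) (at x)" "\<forall>x\<in>I. (g has_vector_derivative g' x) (at x)"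
    by blast
  thus ?case
    by (intro exI[of _ "\<lambda>x. f' x + g' x"]) (auto intro: smooth_closure.add has_vector_derivative_add)
next
  case (mult f g)
  then obtain f' g' where "smooth_closure I f'" "smooth_closure I g'"
    "\<forall>x\<in>I. (f has_vector_derivative f' x) (at x)" "\<forall>x\<in>I. (g has_vector_derivative g' x) (at x)"
    by blast
  thus ?case using mult.hyps
    by (intro exI[of _ "\<lambda>x. f x * g' x + f' x * g x"])
       (auto intro: smooth_closure.add smooth_closure.mult has_vector_derivative_mult)
next
  case (inv f)
  then obtain f' where f': "smooth_closure I f'" "\<forall>x\<in>I. (f has_vector_derivative f' x) (at x)"
    by blast
  have "smooth_closure I (\<lambda>x. - 1 * (inverse (f x) * (f' x * inverse (f x))))"
    by (intro smooth_closure.mult smooth_closure.const smooth_closure.inv inv.hyps f')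
  moreover have "((\<lambda>y. inverse (f y)) has_vector_derivative
      - 1 * (inverse (f x) * (f' x * inverse (f x)))) (at x)" if "x \<in> I" for x
    using has_vector_derivative_inverse[of f "f' x" x] f' inv.hyps that by simp
  ultimately show ?case by blast
next
  case (cnj f)
  then obtain f' where "smooth_closure I f'" "\<forall>x\<in>I. (f has_vector_derivative f' x) (at x)"
    by blast
  thus ?case
    by (intro exI[of _ "\<lambda>x. cnj (f' x)"]) (auto intro: smooth_closure.cnj has_vector_derivative_cnj)
qed

lemma smooth_closure_imp_smooth_on:
  assumes "open I" "smooth_closure I f"
  shows "smooth_on I f"
proof -
  have "\<exists>g. smooth_closure I g \<and> (\<forall>x\<in>I. (dx ^^ k) f x = g x)" for k
  proof (induction k)
    case 0
    show ?case using assms by auto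
  next
    case (Suc k)
    then obtain g where g: "smooth_closure I g" "\<forall>x\<in>I. (dx ^^ k) f x = g x" by blast
    from smooth_closure_derivative[OF g(1)] obtain g' where
      g': "smooth_closure I g'" "\<forall>x\<in>I. (g has_vector_derivative g' x) (at x)" by blast
    have "(dx ^^ Suc k) f x = g' x" if "x \<in> I" for x
      using dx_cong_open[OF \<open>open I\<close> that, of "(dx ^^ k) f" g] g g' that dx_eqI by simp
    with g'(1) show ?case by blast
  qed
  hence "(dx ^^ k) f differentiable (at x)" if "x \<in> I" for k x
  proof -
    obtain g where g: "smooth_closure I g" "\<forall>x\<in>I. (dx ^^ k) f x = g x"
      using \<open>\<And>k. \<exists>g. smooth_closure I g \<and> (\<forall>x\<in>I. (dx ^^ k) f x = g x)\<close> by blast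
    from smooth_closure_derivative[OF g(1)] that obtain d where "(g has_vector_derivative d) (at x)" by blast
    hence "((dx ^^ k) f has_vector_derivative d) (at x)"
      by (rule has_vector_derivative_transform_within_open[OF _ \<open>open I\<close> that]) (use g in auto)
    thus ?thesis by (rule differentiableI_vector)
  qed
  thus ?thesis by (simp add: smooth_on_def)
qed

lemma smooth_on_nlsE:
  assumes "open I" "smooth_on I q" "\<And>x. x \<in> I \<Longrightarrow> q x \<noteq> 0"
  shows "smooth_on I (nlsE q)"
proof -
  have "smooth_closure I (\<lambda>x. \<i> * dx q x * inverse (q x))"
    by (intro smooth_closure.intros smooth_on_dx assms)
  thus ?thesis
    using smooth_closure_imp_smooth_on[OF \<open>open I\<close>] by (simp add: nlsE_def[abs_def] divide_inverse)
qed

lemma smooth_on_nlsF: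
  assumes "open I" "smooth_on I q" "\<And>x. x \<in> I \<Longrightarrow> q x \<noteq> 0"
  shows "smooth_on I (nlsF \<sigma> q)"
proof -
  note E = smooth_on_nlsE[OF assms]
  have "smooth_closure I (\<lambda>x. - (1/4) * (nlsE q x * nlsE q x) + - of_real \<sigma> * (q x * cnj (q x)) + \<i>/2 * dx (nlsE q) x)"
    by (intro smooth_closure.intros smooth_on_dx E assms)
  \<comment> \<open>The modulus enters only through \<open>q * cnj q\<close>, which is smooth although \<open>cmod\<close> need not be.\<close>
  moreover have "nlsF \<sigma> q = (\<lambda>x. - (1/4) * (nlsE q x * nlsE q x) + - of_real \<sigma> * (q x * cnj (q x)) + \<i>/2 * dx (nlsE q) x)"
    by (simp add: nlsF_def[abs_def] power2_eq_square flip: complex_norm_square)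
  ultimately show ?thesis using smooth_closure_imp_smooth_on[OF \<open>open I\<close>] by simp
qed

section \<open>From differential polynomials to functions\<close>

lemma soliton_eq_eval_coeffs: "soliton E F n x = eval_coeffs E F x (solpoly n)"
proof (rule poly_eqI)
  fix j
  have "coeff (soliton E F n x) j = (\<Sum>k=0..n. if k = n - j \<and> j \<le> n then deval E F (solA k) x else 0)"
    unfolding soliton_def coeff_sum coeff_monom by (intro sum.cong) auto
  also have "\<dots> = coeff (eval_coeffs E F x (solpoly n)) j" by (auto simp: coeff_solpoly)
  finally show "coeff (soliton E F n x) j = coeff (eval_coeffs E F x (solpoly n)) j" .
qed

text \<open>The hypothesis on \<open>\<phi>\<close> concerns only points of \<open>I\<close>, so that the lemma can be applied a second
time to \<open>dx_poly \<phi>\<close>, which is under control only there.\<close>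

lemma dx_poly_eval_coeffs:
  assumes "open I" "smooth_on I E" "smooth_on I F" "x \<in> I" "\<And>y. y \<in> I \<Longrightarrow> \<phi> y = eval_coeffs E F y p"
  shows "dx_poly \<phi> x = eval_coeffs E F x (tderiv_poly p)"
proof -
  have "dx (\<lambda>y. coeff (\<phi> y) k) x = coeff (eval_coeffs E F x (tderiv_poly p)) k" for k
  proof -
    have "dx (\<lambda>y. coeff (\<phi> y) k) x = dx (deval E F (coeff p k)) x"
      by (rule dx_cong_open[OF assms(1,4)]) (simp add: assms(5))
    thus ?thesis
      using dx_eqI[OF deval_has_vector_derivative[OF assms(2-4)]] by simp
  qed
  thus ?thesis by (simp only: dx_poly_def coeff_inverse)
qed

lemma calH_eq_eval_coeffs:
  assumes "open I" "smooth_on I E" "smooth_on I F" "x \<in> I"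
  shows "calH E F n x = eval_coeffs E F x (Hpoly (solpoly n))"
proof -
  have 1: "dx_poly (soliton E F n) y = eval_coeffs E F y (tderiv_poly (solpoly n))" if "y \<in> I" for y
    by (rule dx_poly_eval_coeffs[OF assms(1-3) that]) (rule soliton_eq_eval_coeffs)
  have 2: "dx_poly (dx_poly (soliton E F n)) x = eval_coeffs E F x (tderiv_poly (tderiv_poly (solpoly n)))"
    by (rule dx_poly_eval_coeffs[OF assms]) (rule 1)
  show ?thesis
    by (simp add: calH_def Let_def 1[OF assms(4)] 2 soliton_eq_eval_coeffs eval_coeffs_Hpoly)
qed

text \<open>The coefficients of \<open>H\<^sub>n' = \<phi>\<^sub>n (B\<^sub>n - 4 A\<^bsub>n+1\<^esub>' \<lambda>)\<close>. In degree \<open>n + 1 - i\<close> the factor \<open>\<phi>\<^sub>n\<close>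
contributes \<open>A\<^bsub>i-1\<^esub>\<close> against \<open>B\<^sub>n\<close> and \<open>A\<^sub>i\<close> against the linear term.\<close>

lemma coeff_dHpoly_low:
  assumes "i \<in> {1..n}"
  shows "coeff (solpoly n * defect (solpoly n)) (n + 1 - i)
    = - 4 * solA i * tderiv (solA (n + 1)) + solA (i - 1) * solB n"
proof -
  obtain j where j: "i = Suc j" using assms by (cases i) auto
  have "n - j = Suc (n - Suc j)" "n - (n - j) = j" "n - (n - Suc j) = Suc j" using assms j by auto
  thus ?thesis using assms by (simp add: j defect_solpoly mult_pCons_right coeff_solpoly algebra_simps)
qed

lemma coeff_dHpoly_0:
  "coeff (solpoly n * defect (solpoly n)) 0 = solA n * solB n"
  by (simp add: defect_solpoly mult_pCons_right coeff_solpoly)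

lemma coeff_dHpoly_range:
  "coeff (solpoly n * defect (solpoly n)) j \<in> range tderiv"
  unfolding tderiv_poly_Hpoly[symmetric] by simp

text \<open>In degree \<open>n + 1\<close> only \<open>A\<^sub>0 = 2\<close> meets the linear term, and \<open>- 8 A\<^bsub>n+1\<^esub>'\<close> integrates
explicitly because \<open>A\<^bsub>n+1\<^esub>\<close> has zero constant term.\<close>

lemma coeff_dHpoly_mid:
  "tint (coeff (solpoly n * defect (solpoly n)) (n + 1)) = - 8 * solA (Suc n)"
  by (rule tint_eq)
     (simp_all add: defect_solpoly mult_pCons_right coeff_solpoly tderiv_mult tderiv_minus cterm_mult cterm_solA_Suc)

lemma coeff_dHpoly_high:
  "j > n + 1 \<Longrightarrow> tint (coeff (solpoly n * defect (solpoly n)) j) = 0"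
  by (rule tint_eq) (auto simp: defect_solpoly mult_pCons_right coeff_solpoly coeff_pCons split: nat.split)

theorem theorem3p5:
  fixes I :: "real set" and q :: "real \<Rightarrow> complex" and \<sigma> :: real and n :: nat
    and E F :: "real \<Rightarrow> complex"
  assumes "open I" and "is_interval I"
    and "smooth_on I q" and "\<And>x. x \<in> I \<Longrightarrow> q x \<noteq> 0"
    and "\<sigma> = 1 \<or> \<sigma> = -1"
    and "E = nlsE q" and "F = nlsF \<sigma> q"
  shows "(\<forall>i\<in>{1..n}. -4 * solA i * tderiv (solA (n + 1)) + solA (i - 1) * solB n \<in> range tderiv)
    \<and> solA n * solB n \<in> range tderiv
    \<and> (\<forall>x\<in>I. calH E F n x =
          monom 8 (2 * n + 2) - monom (8 * deval E F (solA (n + 1)) x) (n + 1)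
          + (\<Sum>i=1..n. monom (deval E F
               (tint (-4 * solA i * tderiv (solA (n + 1)) + solA (i - 1) * solB n)) x)
               (n + 1 - i))
          + monom (deval E F (tint (solA n * solB n)) x) 0)"
proof (intro conjI ballI)
  fix i assume "i \<in> {1..n}"
  from coeff_dHpoly_low[OF this] coeff_dHpoly_range[of n]
  show "-4 * solA i * tderiv (solA (n + 1)) + solA (i - 1) * solB n \<in> range tderiv" by metis
next
  show "solA n * solB n \<in> range tderiv"
    using coeff_dHpoly_range[of n 0] by (simp only: coeff_dHpoly_0)
next
  fix x assume x: "x \<in> I"
  let ?R = "solpoly n * defect (solpoly n)"
  let ?r = "\<lambda>i. tint (-4 * solA i * tderiv (solA (n + 1)) + solA (i - 1) * solB n)"
  have sE: "smooth_on I E" and sF: "smooth_on I F"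
    using assms smooth_on_nlsE smooth_on_nlsF by simp_all
  have "calH E F n x = eval_coeffs E F x (Hpoly (solpoly n))"
    by (rule calH_eq_eval_coeffs[OF \<open>open I\<close> sE sF x])
  also have "\<dots> = monom 8 (2 * n + 2) - monom (8 * deval E F (solA (n + 1)) x) (n + 1)
      + (\<Sum>i=1..n. monom (deval E F (?r i) x) (n + 1 - i))
      + monom (deval E F (tint (solA n * solB n)) x) 0" (is "_ = ?rhs")
  proof (rule poly_eqI)
    fix j
    have "coeff (\<Sum>i=1..n. monom (deval E F (?r i) x) (n + 1 - i)) j
        = (\<Sum>i=1..n. if i = n + 1 - j \<and> j \<in> {1..n} then deval E F (tint (coeff ?R j)) x else 0)"
      unfolding coeff_sum coeff_monom
    proof (rule sum.cong[OF refl])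
      fix i assume i: "i \<in> {1..n}"
      hence "n + 1 - i = j \<longleftrightarrow> i = n + 1 - j \<and> j \<in> {1..n}" by auto
      thus "(if n + 1 - i = j then deval E F (?r i) x else 0)
          = (if i = n + 1 - j \<and> j \<in> {1..n} then deval E F (tint (coeff ?R j)) x else 0)"
        using coeff_dHpoly_low[OF i] by metis
    qed
    also have "\<dots> = (if j \<in> {1..n} then deval E F (tint (coeff ?R j)) x else 0)"
      by auto
    finally have mid: "coeff (\<Sum>i=1..n. monom (deval E F (?r i) x) (n + 1 - i)) j = \<dots>" .
    \<comment> \<open>Above \<open>n + 1\<close> the derivative of the coefficient vanishes, so only the constant \<open>8\<close> at
      \<open>2 * n + 2\<close> remains.\<close>
    consider "j = 0" | "j \<in> {1..n}" | "j = n + 1" | "j > n + 1" by fastforce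
    thus "coeff (eval_coeffs E F x (Hpoly (solpoly n))) j = coeff ?rhs j"
      unfolding coeff_add coeff_diff mid coeff_monom coeff_eval_coeffs coeff_Hpoly_solpoly
      by cases (simp_all only: coeff_dHpoly_0 coeff_dHpoly_mid coeff_dHpoly_high deval_add,
                auto simp: deval_mult deval_minus)
  qed
  finally show "calH E F n x = ?rhs" .
qed

end
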